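(* Let $X$ be a boundedly sequentially complete locally convex topological vector space. Then $X \in \mathrm{Compl}_b(\mathcal F_{f\text{-}st})$ for every unbounded modulus function $f$.
   Context: Topological vector spaces are Hausdorff, over $\mathbb K \in \{\mathbb R, \mathbb C\}$. A modulus function is an increasing continuous function $f : [0,\infty) \to [0,\infty)$ with $f(0) = 0$ and $f(x+y) \le f(x) + f(y)$ for all $x,y \ge 0$. For $A \subset \mathbb N$, the $f$-density of $A$ is $d_f(A) = \lim_{n\to\infty} \frac{f(|A \cap \{1,\dots,n\}|)}{f(n)}$, when the limit exists. For an unbounded modulus $f$, $\mathcal F_{f\text{-}st}$ is the filter of all $B \subset \mathbb N$ such that $d_f(\mathbb N \setminus B) = 0$. For a filter $\mathcal F$ on $\mathbb N$, a sequence $(x_n) \subset X$ is a Cauchy sequence over $\mathcal F$ if for every neighborhood $U$ of $0$ there is $B \in \mathcal F$ with $x_n - x_m \in U$ for all $n,m \in B$; it has limit $y \in X$ over $\mathcal F$ if for every neighborhood $V$ of $y$ there is $B \in \mathcal F$ with $x_n \in V$ for all $n \in B$. $X$ is boundedly complete over $\mathcal F$, written $X \in \mathrm{Compl}_b(\mathcal F)$, if every bounded sequence in $X$ that is Cauchy over $\mathcal F$ has a limit over $\mathcal F$ in $X$. $X$ is boundedly sequentially complete if every bounded ordinary Cauchy sequence in $X$ converges, i.e. $X$ is boundedly complete over the Fréchet filter of cofinite subsets of $\mathbb N$. *)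

theory Defs
  imports "HOL-Analysis.Analysis"
begin

definition neighborhood :: "'a::topological_space \<Rightarrow> 'a set \<Rightarrow> bool" where
  "neighborhood x U \<longleftrightarrow> x \<in> interior U"

(* By the Gelfand-Mazur theorem, a real_normed_field is isometrically isomorphic to
   the reals or to the complex numbers, so the scalar type 'k covers exactly these two
   cases. The Hausdorff axiom and the continuity of the group operations are carried
   by the sort of 'a. *)
locale topological_vector_space = vector_space smul
  for smul :: "'k::real_normed_field \<Rightarrow> 'a::{topological_ab_group_add,t2_space} \<Rightarrow> 'a" +
  assumes continuous_scale: "continuous_on UNIV (\<lambda>(c, x). smul c x)"

(* The library's convex is tied to the class real_vector, hence to the constant scaleR. *)
definition convex_wrt :: "('k::real_normed_field \<Rightarrow> 'a::ab_group_add \<Rightarrow> 'a) \<Rightarrow> 'a set \<Rightarrow> bool" where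
  "convex_wrt smul S \<longleftrightarrow>
    (\<forall>x\<in>S. \<forall>y\<in>S. \<forall>u\<ge>0. \<forall>v\<ge>0. u + v = 1 \<longrightarrow>
      smul (of_real u) x + smul (of_real v) y \<in> S)"

locale locally_convex_space = topological_vector_space smul
  for smul :: "'k::real_normed_field \<Rightarrow> 'a::{topological_ab_group_add,t2_space} \<Rightarrow> 'a" +
  assumes locally_convex:
    "neighborhood 0 U \<Longrightarrow> \<exists>V. neighborhood 0 V \<and> convex_wrt smul V \<and> V \<subseteq> U"

(* Boundedness in the sense of topological vector spaces: S is absorbed by every
   neighborhood of 0. *)
definition tvs_bounded ::
  "('k::real_normed_field \<Rightarrow> 'a::{topological_space,ab_group_add} \<Rightarrow> 'a) \<Rightarrow> 'a set \<Rightarrow> bool" where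
  "tvs_bounded smul S \<longleftrightarrow>
    (\<forall>U. neighborhood 0 U \<longrightarrow> (\<exists>r>0. \<forall>c. norm c \<ge> r \<longrightarrow> S \<subseteq> smul c ` U))"

definition Cauchy_over :: "nat filter \<Rightarrow> (nat \<Rightarrow> 'a::{topological_space,ab_group_add}) \<Rightarrow> bool" where
  "Cauchy_over F x \<longleftrightarrow>
    (\<forall>U. neighborhood 0 U \<longrightarrow>
      (\<exists>B. eventually (\<lambda>n. n \<in> B) F \<and> (\<forall>n\<in>B. \<forall>m\<in>B. x n - x m \<in> U)))"

definition boundedly_complete_over ::
  "('k::real_normed_field \<Rightarrow> 'a::{topological_space,ab_group_add} \<Rightarrow> 'a) \<Rightarrow> nat filter \<Rightarrow> bool" where
  "boundedly_complete_over smul F \<longleftrightarrow>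
    (\<forall>x. tvs_bounded smul (range x) \<and> Cauchy_over F x \<longrightarrow> (\<exists>y. (x \<longlongrightarrow> y) F))"

definition boundedly_sequentially_complete ::
  "('k::real_normed_field \<Rightarrow> 'a::{topological_space,ab_group_add} \<Rightarrow> 'a) \<Rightarrow> bool" where
  "boundedly_sequentially_complete smul \<longleftrightarrow> boundedly_complete_over smul cofinite"

(* Only the values of f on the nonnegative reals matter. *)
definition modulus_function :: "(real \<Rightarrow> real) \<Rightarrow> bool" where
  "modulus_function f \<longleftrightarrow>
    f \<in> {0..} \<rightarrow> {0..} \<and> mono_on {0..} f \<and> continuous_on {0..} f \<and> f 0 = 0 \<and>
    (\<forall>x\<ge>0. \<forall>y\<ge>0. f (x + y) \<le> f x + f y)"

definition unbounded_modulus :: "(real \<Rightarrow> real) \<Rightarrow> bool" where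
  "unbounded_modulus f \<longleftrightarrow> modulus_function f \<and> \<not> bounded (f ` {0..})"

(* Positive integers are counted; the number 0 of type nat is invisible to the density. *)
definition has_density :: "(real \<Rightarrow> real) \<Rightarrow> nat set \<Rightarrow> real \<Rightarrow> bool" where
  "has_density f A d \<longleftrightarrow>
    (\<lambda>n. f (real (card (A \<inter> {1..n}))) / f (real n)) \<longlonglongrightarrow> d"

(* Meaningful for a modulus function f, as eventually_f_st_filter shows. *)
definition f_st_filter :: "(real \<Rightarrow> real) \<Rightarrow> nat filter" where
  "f_st_filter f = Abs_filter (\<lambda>P. has_density f (- {n. P n}) 0)"

lemma modulus_function_nonneg: "modulus_function f \<Longrightarrow> 0 \<le> t \<Longrightarrow> 0 \<le> f t"
  unfolding modulus_function_def Pi_def by simp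

lemma modulus_function_mono: "modulus_function f \<Longrightarrow> 0 \<le> s \<Longrightarrow> s \<le> t \<Longrightarrow> f s \<le> f t"
  by (rule mono_onD[of "{0..}" f]) (simp_all add: modulus_function_def)

lemma has_density_zero_subset:
  assumes f: "modulus_function f" and B: "has_density f B 0" and "A \<subseteq> B"
  shows "has_density f A 0"
  unfolding has_density_def
proof (rule tendsto_sandwich[OF _ _ tendsto_const B[unfolded has_density_def]])
  note nonneg = modulus_function_nonneg[OF f] and mono = modulus_function_mono[OF f]
  show "\<forall>\<^sub>F n in sequentially. 0 \<le> f (real (card (A \<inter> {1..n}))) / f (real n)"
    by (intro always_eventually allI divide_nonneg_nonneg nonneg) simp_all
  have "f (real (card (A \<inter> {1..n}))) \<le> f (real (card (B \<inter> {1..n})))" for n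
  proof -
    have "card (A \<inter> {1..n}) \<le> card (B \<inter> {1..n})"
      using \<open>A \<subseteq> B\<close> by (intro card_mono) auto
    then show ?thesis
      by (intro mono) simp_all
  qed
  then show "\<forall>\<^sub>F n in sequentially. f (real (card (A \<inter> {1..n}))) / f (real n)
      \<le> f (real (card (B \<inter> {1..n}))) / f (real n)"
    by (intro always_eventually allI divide_right_mono nonneg) auto
qed

lemma has_density_zero_Un:
  assumes f: "modulus_function f" and A: "has_density f A 0" and B: "has_density f B 0"
  shows "has_density f (A \<union> B) 0"
  unfolding has_density_def
proof (rule tendsto_sandwich[OF _ _ tendsto_const])
  note nonneg = modulus_function_nonneg[OF f] and mono = modulus_function_mono[OF f]
  let ?g = "\<lambda>A n. f (real (card (A \<inter> {1..n})))"
  show "\<forall>\<^sub>F n in sequentially. 0 \<le> ?g (A \<union> B) n / f (real n)"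
    by (intro always_eventually allI divide_nonneg_nonneg nonneg) simp_all
  have "?g (A \<union> B) n \<le> ?g A n + ?g B n" for n
  proof -
    have "real (card ((A \<union> B) \<inter> {1..n})) \<le> real (card (A \<inter> {1..n})) + real (card (B \<inter> {1..n}))"
      using card_Un_le[of "A \<inter> {1..n}" "B \<inter> {1..n}"]
      unfolding Int_Un_distrib2 of_nat_add[symmetric] of_nat_le_iff .
    then have "?g (A \<union> B) n \<le> f (real (card (A \<inter> {1..n})) + real (card (B \<inter> {1..n})))"
      by (intro mono) simp_all
    also have "\<dots> \<le> ?g A n + ?g B n"
      using f by (simp add: modulus_function_def)
    finally show ?thesis .
  qed
  then show "\<forall>\<^sub>F n in sequentially. ?g (A \<union> B) n / f (real n)
      \<le> ?g A n / f (real n) + ?g B n / f (real n)"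
    unfolding add_divide_distrib[symmetric]
    by (intro always_eventually allI divide_right_mono nonneg) auto
  show "(\<lambda>n. ?g A n / f (real n) + ?g B n / f (real n)) \<longlonglongrightarrow> 0"
    using tendsto_add[OF A[unfolded has_density_def] B[unfolded has_density_def]] by simp
qed

lemma eventually_f_st_filter:
  assumes f: "modulus_function f"
  shows "eventually P (f_st_filter f) \<longleftrightarrow> has_density f (- {n. P n}) 0"
  unfolding f_st_filter_def
proof (rule eventually_Abs_filter, rule is_filter.intro)
  show "has_density f (- {n. True}) 0"
    using f by (simp add: has_density_def modulus_function_def)
next
  fix P Q
  assume "has_density f (- {n. P n}) 0" "has_density f (- {n. Q n}) 0"
  from has_density_zero_Un[OF f this]
  show "has_density f (- {n. P n \<and> Q n}) 0"
    by (simp add: Collect_conj_eq)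
next
  fix P Q :: "nat \<Rightarrow> bool"
  assume "\<forall>n. P n \<longrightarrow> Q n" "has_density f (- {n. P n}) 0"
  then show "has_density f (- {n. Q n}) 0"
    by (elim has_density_zero_subset[OF f]) auto
qed

end

theory Submission imports Defs begin

text \<open>
  A bounded sequence \<open>x\<close> that is Cauchy over a filter need not be Cauchy and, outside metrizable
  spaces, may even have no Cauchy subsequence, but its arithmetic means
  \<open>y n = (x 1 + \<dots> + x n) / n\<close> are Cauchy in the ordinary sense as soon as
  the complement of every set in the filter has natural density zero. Indeed, let \<open>V\<close> be a convex
  neighborhood of \<open>0\<close> and let \<open>B\<close> be a set in the filter on which \<open>x\<close> varies by elements of
  \<open>V\<close>. For \<open>k \<in> B\<close> the difference \<open>y n - x k\<close> is the mean of the differences \<open>x j - x k\<close> with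
  \<open>1 \<le> j \<le> n\<close>. Those with \<open>j \<in> B\<close> lie in \<open>V\<close>; the others lie in a fixed multiple \<open>r V\<close>, since
  \<open>x\<close> is bounded, but the proportion of such \<open>j\<close> is at most \<open>1 / r\<close> once \<open>n\<close> is large. By convexity
  the mean lies in \<open>2 V\<close>. Thus \<open>y n - x k\<close> is small for all \<open>k \<in> B\<close> and all large \<open>n\<close>, uniformly in
  both (lemma \<open>means_close_to_sequence\<close>).

  This estimate does two things. Comparing \<open>y n\<close> and \<open>y m\<close> with one common \<open>x k\<close> shows that \<open>y\<close> is an
  ordinary Cauchy sequence; it is bounded by convexity, so it has a limit. Comparing \<open>x k\<close> with
  \<open>y n\<close> for a large \<open>n\<close> then shows that \<open>x\<close> has the same limit over the filter
  (lemma \<open>boundedly_complete_over_density_filter\<close>).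

  It remains to see that \<open>f\<close>-density zero implies natural density zero. Subadditivity gives
  \<open>f n \<le> p * f (n / p)\<close>, so a set whose counting function \<open>c\<close> satisfies \<open>f (c n) < f n / p\<close> also
  satisfies \<open>f (c n) < f (n / p)\<close>, whence \<open>c n < n / p\<close> by monotonicity
  (lemma \<open>has_density_zero_imp_natural_density_zero\<close>).
\<close>

section \<open>Density zero with respect to a modulus function\<close>

lemma modulus_function_of_nat_mult:
  assumes "modulus_function f" "0 \<le> t"
  shows "f (real p * t) \<le> real p * f t"
proof (induction p)
  case 0
  then show ?case
    using assms by (simp add: modulus_function_def)
next
  case (Suc p)
  have "f (real (Suc p) * t) \<le> f (real p * t) + f t"
    using assms by (simp add: modulus_function_def algebra_simps)
  with Suc show ?case
    by (simp add: algebra_simps)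
qed

lemma unbounded_modulus_eventually_pos:
  assumes "unbounded_modulus f"
  shows "\<forall>\<^sub>F n in sequentially. 0 < f (real n)"
proof -
  have f: "modulus_function f" and unb: "\<not> bounded (f ` {0..})"
    using assms by (auto simp: unbounded_modulus_def)
  obtain t where t: "0 \<le> t" "0 < f t"
  proof -
    have "\<not> (\<forall>y\<in>f ` {0..}. norm y \<le> 0)"
      using unb unfolding bounded_iff by blast
    then obtain t where "0 \<le> t" "f t \<noteq> 0"
      by auto
    then show ?thesis
      using that modulus_function_nonneg[OF f, of t] by auto
  qed
  show ?thesis
    using eventually_ge_at_top[of "nat \<lceil>t\<rceil>"]
  proof eventually_elim
    case (elim n)
    then have "f t \<le> f (real n)"
      using t by (intro modulus_function_mono[OF f]) linarith+
    with t show ?case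
      by simp
  qed
qed

text \<open>
  By subadditivity \<open>f n / p \<le> f (n / p)\<close>, and monotonicity turns a strict inequality between values
  of \<open>f\<close> into one between arguments. Since \<open>f\<close> is unbounded, \<open>f n > 0\<close> for large \<open>n\<close>; otherwise a
  small ratio could come from the convention \<open>t / 0 = 0\<close> and say nothing about its numerator.
\<close>

lemma has_density_zero_imp_natural_density_zero:
  assumes unb: "unbounded_modulus f" and A: "has_density f A 0"
  shows "has_density (\<lambda>t. t) A 0"
  unfolding has_density_def
proof (rule order_tendstoI)
  fix e :: real
  assume "e < 0"
  then show "\<forall>\<^sub>F n in sequentially. e < real (card (A \<inter> {1..n})) / real n"
    by (intro always_eventually allI) (rule less_le_trans, auto)
next
  fix e :: real
  assume "0 < e"
  then obtain p where p: "0 < p" "1 / real p < e"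
    using reals_Archimedean[of e] by (metis inverse_eq_divide zero_less_Suc)
  have f: "modulus_function f"
    using unb by (simp add: unbounded_modulus_def)
  have "\<forall>\<^sub>F n in sequentially. f (real (card (A \<inter> {1..n}))) / f (real n) < 1 / real p"
    using p by (intro order_tendstoD(2)[OF A[unfolded has_density_def]]) simp
  with unbounded_modulus_eventually_pos[OF unb] eventually_gt_at_top[of 0]
  show "\<forall>\<^sub>F n in sequentially. real (card (A \<inter> {1..n})) / real n < e"
  proof eventually_elim
    case (elim n)
    let ?c = "real (card (A \<inter> {1..n}))"
    have "f (real n) \<le> real p * f (real n / real p)"
      using modulus_function_of_nat_mult[OF f, of "real n / real p" p] p by simp
    moreover have "real p * f ?c < f (real n)"
      using elim p by (simp add: field_simps)
    ultimately have "f ?c < f (real n / real p)"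
      using p by (smt (verit) mult_left_mono of_nat_0_le_iff)
    then have "?c < real n / real p"
      using modulus_function_mono[OF f, of "real n / real p" ?c] by fastforce
    then have "?c / real n < 1 / real p"
      using elim p by (simp add: field_simps)
    with p show ?case
      by simp
  qed
qed

lemma natural_density_zero_ne_UNIV:
  assumes "has_density (\<lambda>t. t) A 0"
  shows "A \<noteq> UNIV"
proof
  assume "A = UNIV"
  then have "(\<lambda>n. real n / real n) \<longlonglongrightarrow> 0"
    using assms by (simp add: has_density_def)
  moreover have "(\<lambda>n. real n / real n) \<longlonglongrightarrow> 1"
    by (rule tendsto_eventually) (use eventually_gt_at_top[of 0] in \<open>eventually_elim, simp\<close>)
  ultimately show False
    using LIMSEQ_unique by fastforce
qed

section \<open>Neighborhoods of zero in topological groups\<close>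

lemma zero_mem_neighborhood: "neighborhood 0 U \<Longrightarrow> 0 \<in> U"
  unfolding neighborhood_def using interior_subset by blast

lemma eventually_nhds_zero_imp_neighborhood:
  assumes "eventually P (nhds 0)"
  shows "neighborhood 0 {a. P a}"
  using assms unfolding neighborhood_def eventually_nhds by (auto intro: interiorI)

lemma neighborhood_imp_eventually_nhds:
  assumes "neighborhood x U"
  shows "\<forall>\<^sub>F a in nhds x. a \<in> U"
  using assms interior_subset[of U] unfolding neighborhood_def eventually_nhds
  by (intro exI[of _ "interior U"]) auto

lemma neighborhood_zero_binary:
  fixes g :: "'a::{topological_space,zero} \<Rightarrow> 'a \<Rightarrow> 'a"
  assumes lim: "((\<lambda>p. g (fst p) (snd p)) \<longlongrightarrow> 0) (nhds 0 \<times>\<^sub>F nhds 0)"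
    and U: "neighborhood 0 U"
  shows "\<exists>V. neighborhood 0 V \<and> (\<forall>a\<in>V. \<forall>b\<in>V. g a b \<in> U)"
proof -
  have "\<forall>\<^sub>F p in nhds 0 \<times>\<^sub>F nhds 0. g (fst p) (snd p) \<in> U"
    using lim neighborhood_imp_eventually_nhds[OF U] unfolding filterlim_iff by blast
  then obtain P where "eventually P (nhds 0)" "\<And>a b. P a \<Longrightarrow> P b \<Longrightarrow> g a b \<in> U"
    unfolding eventually_prod_same by auto
  then show ?thesis
    by (intro exI[of _ "{a. P a}"]) (auto intro: eventually_nhds_zero_imp_neighborhood)
qed

lemma neighborhood_zero_add:
  fixes U :: "'a::topological_ab_group_add set"
  assumes "neighborhood 0 U"
  shows "\<exists>V. neighborhood 0 V \<and> (\<forall>a\<in>V. \<forall>b\<in>V. a + b \<in> U)"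
  using tendsto_add_Pair[of "0::'a" 0] assms by (intro neighborhood_zero_binary) simp_all

lemma neighborhood_zero_diff:
  fixes U :: "'a::topological_ab_group_add set"
  assumes "neighborhood 0 U"
  shows "\<exists>V. neighborhood 0 V \<and> (\<forall>a\<in>V. \<forall>b\<in>V. a - b \<in> U)"
proof (rule neighborhood_zero_binary[OF _ assms])
  have "((\<lambda>p::'a \<times> 'a. fst p - snd p) \<longlongrightarrow> 0 - 0) (nhds 0 \<times>\<^sub>F nhds 0)"
    by (intro tendsto_diff filterlim_fst filterlim_snd)
  then show "((\<lambda>p::'a \<times> 'a. fst p - snd p) \<longlongrightarrow> 0) (nhds 0 \<times>\<^sub>F nhds 0)"
    by simp
qed

lemma tendsto_iff_diff_neighborhood:
  fixes x :: "'b \<Rightarrow> 'a::topological_ab_group_add"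
  shows "(x \<longlongrightarrow> y) F \<longleftrightarrow> (\<forall>U. neighborhood 0 U \<longrightarrow> (\<forall>\<^sub>F n in F. x n - y \<in> U))"
proof
  assume "(x \<longlongrightarrow> y) F"
  then have lim: "((\<lambda>n. x n - y) \<longlongrightarrow> 0) F"
    using tendsto_diff[of x y F "\<lambda>_. y" y] by simp
  show "\<forall>U. neighborhood 0 U \<longrightarrow> (\<forall>\<^sub>F n in F. x n - y \<in> U)"
    using lim neighborhood_imp_eventually_nhds unfolding filterlim_iff by blast
next
  assume small: "\<forall>U. neighborhood 0 U \<longrightarrow> (\<forall>\<^sub>F n in F. x n - y \<in> U)"
  have "((\<lambda>n. x n - y) \<longlongrightarrow> 0) F"
  proof (rule topological_tendstoI)
    fix S :: "'a set"
    assume "open S" "0 \<in> S"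
    then show "\<forall>\<^sub>F n in F. x n - y \<in> S"
      using small by (simp add: neighborhood_def interior_open)
  qed
  then have "((\<lambda>n. (x n - y) + y) \<longlongrightarrow> 0 + y) F"
    by (intro tendsto_add tendsto_const)
  then show "(x \<longlongrightarrow> y) F"
    by simp
qed

section \<open>Nonnegative combinations and arithmetic means\<close>

text \<open>
  The index \<open>0\<close> is left out because densities do not count it. At \<open>n = 0\<close> the sum is empty, so the
  weights sum to \<open>0\<close> instead of \<open>1\<close>.
\<close>

definition mean_seq ::
  "('k::real_normed_field \<Rightarrow> 'a::ab_group_add \<Rightarrow> 'a) \<Rightarrow> (nat \<Rightarrow> 'a) \<Rightarrow> nat \<Rightarrow> 'a" where
  "mean_seq smul x n = (\<Sum>k\<in>{1..n}. smul (of_real (1 / real n)) (x k))"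

context topological_vector_space
begin

text \<open>
  The total weight stays as a factor instead of being normalized to \<open>1\<close>. The statement then holds
  for partial sums of every weight, \<open>0\<close> included, so that it can be its own induction hypothesis.
\<close>

lemma convex_wrt_nonneg_combination:
  assumes V: "convex_wrt smul V" "0 \<in> V" and "finite K"
    and "\<And>k. k \<in> K \<Longrightarrow> 0 \<le> w k" "\<And>k. k \<in> K \<Longrightarrow> v k \<in> V"
  shows "\<exists>a\<in>V. (\<Sum>k\<in>K. smul (of_real (w k)) (v k)) = smul (of_real (\<Sum>k\<in>K. w k)) a"
  using assms(3-)
proof (induction K rule: finite_induct)
  case empty
  then show ?case
    using V by auto
next
  case (insert k K)
  define s where "s = (\<Sum>k\<in>K. w k)"
  obtain a where a: "a \<in> V" "(\<Sum>k\<in>K. smul (of_real (w k)) (v k)) = smul (of_real s) a"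
    using insert unfolding s_def by auto
  have s: "0 \<le> s" and k: "0 \<le> w k" "v k \<in> V"
    using insert by (auto simp: s_def intro: sum_nonneg)
  have eq: "(\<Sum>k\<in>insert k K. smul (of_real (w k)) (v k)) = smul (of_real (w k)) (v k) + smul (of_real s) a"
    "(\<Sum>k\<in>insert k K. w k) = w k + s"
    using insert a by (simp_all add: s_def)
  show ?case
  proof (cases "w k + s = 0")
    case True
    with s k have "w k = 0" "s = 0"
      by auto
    then show ?thesis
      unfolding eq using V by auto
  next
    case False
    let ?t = "w k + s"
    let ?b = "smul (of_real (w k / ?t)) (v k) + smul (of_real (s / ?t)) a"
    have "w k / ?t + s / ?t = 1"
      using False by (simp add: add_divide_distrib[symmetric])
    then have "?b \<in> V"
      using V(1) a(1) k s unfolding convex_wrt_def by (simp del: of_real_divide of_real_add)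
    moreover have "smul (of_real ?t) ?b = smul (of_real (w k)) (v k) + smul (of_real s) a"
    proof -
      have "of_real ?t * of_real (u / ?t) = (of_real u :: 'k)" for u
        unfolding of_real_mult[symmetric] using False by simp
      then show ?thesis
        by (simp only: scale_right_distrib scale_scale)
    qed
    ultimately show ?thesis
      unfolding eq by metis
  qed
qed

lemma convex_wrt_scale_mem:
  assumes "convex_wrt smul V" "0 \<in> V" "a \<in> V" "0 \<le> t" "t \<le> 1"
  shows "smul (of_real t) a \<in> V"
proof -
  have "smul (of_real t) a + smul (of_real (1 - t)) 0 \<in> V"
    using assms unfolding convex_wrt_def by (metis add.commute diff_add_cancel diff_ge_0_iff_ge)
  then show ?thesis
    by simp
qed

lemma mean_seq_diff_const:
  assumes "0 < n"
  shows "mean_seq smul x n - a = (\<Sum>k\<in>{1..n}. smul (of_real (1 / real n)) (x k - a))"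
proof -
  have "(\<Sum>k\<in>{1..n}. smul (of_real (1 / real n)) a) = smul (\<Sum>k\<in>{1..n}. of_real (1 / real n)) a"
    by (rule scale_sum_left[symmetric])
  also have "\<dots> = a"
    using assms by simp
  finally show ?thesis
    by (simp add: mean_seq_def scale_right_diff_distrib sum_subtractf)
qed

end

context locally_convex_space
begin

text \<open>
  All terms of \<open>x\<close> have the form \<open>smul c v\<close> with \<open>v\<close> in a convex neighborhood and one common \<open>c\<close>,
  and scalars commute, so the averaging takes place on the vectors \<open>v\<close>.
\<close>

lemma tvs_bounded_mean_seq:
  assumes "tvs_bounded smul (range x)"
  shows "tvs_bounded smul (range (mean_seq smul x))"
  unfolding tvs_bounded_def
proof (intro allI impI)
  fix U :: "'a set"
  assume "neighborhood 0 U"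
  then obtain V where V: "neighborhood 0 V" "convex_wrt smul V" "V \<subseteq> U"
    using locally_convex by blast
  note zero = zero_mem_neighborhood[OF V(1)]
  obtain r where r: "0 < r" "\<And>c. r \<le> norm c \<Longrightarrow> range x \<subseteq> smul c ` V"
    using assms V(1) unfolding tvs_bounded_def by blast
  have "mean_seq smul x n \<in> smul c ` U" if c: "r \<le> norm c" for c n
  proof -
    have "\<forall>k. \<exists>v\<in>V. x k = smul c v"
      using r(2)[OF c] by blast
    then obtain v where v: "\<And>k. v k \<in> V" "\<And>k. x k = smul c (v k)"
      by metis
    obtain a where a: "a \<in> V"
      "(\<Sum>k\<in>{1..n}. smul (of_real (1 / real n)) (v k)) = smul (of_real (\<Sum>k\<in>{1..n}. 1 / real n)) a"
      using convex_wrt_nonneg_combination[OF V(2) zero, of "{1..n}" "\<lambda>_. 1 / real n" v] v(1) by auto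
    have "mean_seq smul x n = smul c (\<Sum>k\<in>{1..n}. smul (of_real (1 / real n)) (v k))"
      by (simp add: mean_seq_def v(2) scale_sum_right mult.commute)
    moreover have "smul (of_real (\<Sum>k\<in>{1..n}. 1 / real n)) a \<in> V"
      by (rule convex_wrt_scale_mem[OF V(2) zero a(1)]) auto
    ultimately show ?thesis
      using V(3) unfolding a(2) by blast
  qed
  then show "\<exists>r>0. \<forall>c. r \<le> norm c \<longrightarrow> range (mean_seq smul x) \<subseteq> smul c ` U"
    using r(1) by blast
qed

lemma tvs_bounded_differences:
  assumes "tvs_bounded smul (range x)" "neighborhood 0 V"
  shows "\<exists>r>0. \<forall>j k. \<exists>v\<in>V. x j - x k = smul (of_real r) v"
proof -
  obtain W where W: "neighborhood 0 W" "\<And>a b. a \<in> W \<Longrightarrow> b \<in> W \<Longrightarrow> a - b \<in> V"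
    using neighborhood_zero_diff[OF assms(2)] by blast
  obtain r where r: "0 < r" "\<And>c. r \<le> norm c \<Longrightarrow> range x \<subseteq> smul c ` W"
    using assms(1) W(1) unfolding tvs_bounded_def by blast
  have "\<exists>v\<in>V. x j - x k = smul (of_real r) v" for j k
  proof -
    have "range x \<subseteq> smul (of_real r) ` W"
      using r by simp
    then obtain a b where "a \<in> W" "b \<in> W" "x j = smul (of_real r) a" "x k = smul (of_real r) b"
      by (metis imageE rangeI subsetD)
    then show ?thesis
      using W(2) by (metis scale_right_diff_distrib)
  qed
  with r(1) show ?thesis
    by blast
qed

section \<open>Completeness over filters of sets of natural density one\<close>

text \<open>
  In the mean of the differences \<open>x j - x k\<close>, where \<open>x\<close> varies by elements of a convex \<open>V\<close> on \<open>B\<close>,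
  the terms with \<open>j\<close> outside \<open>B\<close> are only known to lie in \<open>r V\<close>. The factor \<open>r\<close> is moved into the
  weights: for large \<open>n\<close> these sum to at most \<open>2\<close>, because \<open>- B\<close> has natural density zero. That
  the bound on \<open>n\<close> does not depend on \<open>k\<close> is what lets a single mean approximate all \<open>x k\<close> with
  \<open>k \<in> B\<close>, and hence identifies the limit of \<open>x\<close>.
\<close>

lemma means_close_to_sequence:
  assumes bdd: "tvs_bounded smul (range x)" and Cauchy: "Cauchy_over F x"
    and dens: "\<And>P. eventually P F \<Longrightarrow> has_density (\<lambda>t. t) (- {n. P n}) 0"
    and U: "neighborhood 0 U"
  shows "\<exists>B. (\<forall>\<^sub>F k in F. k \<in> B) \<and>
    (\<forall>\<^sub>F n in sequentially. \<forall>k\<in>B. mean_seq smul x n - x k \<in> U)"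
proof -
  obtain V' where V': "neighborhood 0 V'" "\<And>a b. a \<in> V' \<Longrightarrow> b \<in> V' \<Longrightarrow> a + b \<in> U"
    using neighborhood_zero_add[OF U] by blast
  obtain V where V: "neighborhood 0 V" "convex_wrt smul V" "V \<subseteq> V'"
    using locally_convex[OF V'(1)] by blast
  note zero = zero_mem_neighborhood[OF V(1)]
  obtain r where r: "0 < r" "\<And>j k. \<exists>v\<in>V. x j - x k = smul (of_real r) v"
    using tvs_bounded_differences[OF bdd V(1)] by blast
  obtain B where B: "\<forall>\<^sub>F k in F. k \<in> B" "\<And>j k. j \<in> B \<Longrightarrow> k \<in> B \<Longrightarrow> x j - x k \<in> V"
    using Cauchy V(1) unfolding Cauchy_over_def by blast
  have "(\<lambda>n. real (card (- B \<inter> {1..n})) / real n) \<longlonglongrightarrow> 0"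
    using dens[OF B(1)] by (simp add: has_density_def)
  from order_tendstoD(2)[OF this, of "1 / r"] r(1)
  have "\<forall>\<^sub>F n in sequentially. real (card (- B \<inter> {1..n})) / real n < 1 / r"
    by simp
  then have "\<forall>\<^sub>F n in sequentially. \<forall>k\<in>B. mean_seq smul x n - x k \<in> U"
    using eventually_gt_at_top[of 0]
  proof eventually_elim
    case (elim n)
    show ?case
    proof
      fix k
      assume k: "k \<in> B"
      define w where "w j = (if j \<in> B then 1 / real n else r / real n)" for j
      have "\<exists>v\<in>V. smul (of_real (1 / real n)) (x j - x k) = smul (of_real (w j)) v" for j
      proof (cases "j \<in> B")
        case True
        then show ?thesis
          using B(2)[OF True k] by (auto simp: w_def)
      next
        case False
        then show ?thesis
          using r(2)[of j k] by (auto simp: w_def)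
      qed
      then obtain v where v: "\<And>j. v j \<in> V"
        "\<And>j. smul (of_real (1 / real n)) (x j - x k) = smul (of_real (w j)) (v j)"
        by metis
      define s where "s = (\<Sum>j\<in>{1..n}. w j)"
      have w_nonneg: "0 \<le> w j" for j
        using r(1) by (simp add: w_def)
      obtain a where a: "a \<in> V" "(\<Sum>j\<in>{1..n}. smul (of_real (w j)) (v j)) = smul (of_real s) a"
        using convex_wrt_nonneg_combination[OF V(2) zero, of "{1..n}" w v] v(1) w_nonneg
        unfolding s_def by auto
      have "0 \<le> s"
        unfolding s_def using w_nonneg by (intro sum_nonneg)
      have "s \<le> (\<Sum>j\<in>{1..n}. 1 / real n + (if j \<in> - B then r / real n else 0))"
        unfolding s_def by (intro sum_mono) (simp add: w_def)
      also have "\<dots> = 1 + r * (real (card (- B \<inter> {1..n})) / real n)"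
        using elim by (simp add: sum.distrib sum.If_cases Int_commute Collect_neg_eq)
      also have "\<dots> \<le> 2"
        using elim r(1) by (simp add: field_simps)
      finally have "s \<le> 2" .
      have half: "smul (of_real (s / 2)) a \<in> V"
        using \<open>0 \<le> s\<close> \<open>s \<le> 2\<close> by (intro convex_wrt_scale_mem[OF V(2) zero a(1)]) auto
      have "mean_seq smul x n - x k = smul (of_real s) a"
        using elim by (simp only: mean_seq_diff_const v(2) a(2))
      also have "\<dots> = smul (of_real (s / 2)) a + smul (of_real (s / 2)) a"
        unfolding scale_left_distrib[symmetric] of_real_add[symmetric] by simp
      finally show "mean_seq smul x n - x k \<in> U"
        using half V(3) V'(2) by auto
    qed
  qed
  with B(1) show ?thesis
    by blast
qed

lemma boundedly_complete_over_density_filter: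
  assumes complete: "boundedly_sequentially_complete smul"
    and dens: "\<And>P. eventually P F \<Longrightarrow> has_density (\<lambda>t. t) (- {n. P n}) 0"
  shows "boundedly_complete_over smul F"
  unfolding boundedly_complete_over_def
proof (intro allI impI, elim conjE)
  fix x :: "nat \<Rightarrow> 'a"
  assume bdd: "tvs_bounded smul (range x)" and Cauchy: "Cauchy_over F x"
  note close = means_close_to_sequence[OF bdd Cauchy, rotated, OF _ dens]
  let ?y = "mean_seq smul x"
  have "Cauchy_over sequentially ?y"
    unfolding Cauchy_over_def
  proof (intro allI impI)
    fix U :: "'a set"
    assume "neighborhood 0 U"
    then obtain V where V: "neighborhood 0 V" "\<And>a b. a \<in> V \<Longrightarrow> b \<in> V \<Longrightarrow> a - b \<in> U"
      using neighborhood_zero_diff by blast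
    obtain B where B: "\<forall>\<^sub>F k in F. k \<in> B" "\<forall>\<^sub>F n in sequentially. \<forall>k\<in>B. ?y n - x k \<in> V"
      using close[OF V(1)] by blast
    have "B \<noteq> {}"
      using natural_density_zero_ne_UNIV[OF dens[OF B(1)]] by auto
    then obtain k where "k \<in> B"
      by blast
    let ?C = "{n. ?y n - x k \<in> V}"
    have "\<forall>\<^sub>F n in sequentially. n \<in> ?C"
      using B(2) \<open>k \<in> B\<close> by (auto elim: eventually_mono)
    moreover have "?y n - ?y m \<in> U" if "n \<in> ?C" "m \<in> ?C" for n m
      using V(2)[of "?y n - x k" "?y m - x k"] that by simp
    ultimately show "\<exists>C. (\<forall>\<^sub>F n in sequentially. n \<in> C) \<and> (\<forall>n\<in>C. \<forall>m\<in>C. ?y n - ?y m \<in> U)"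
      by blast
  qed
  then obtain y where y: "?y \<longlonglongrightarrow> y"
    using complete tvs_bounded_mean_seq[OF bdd]
    unfolding boundedly_sequentially_complete_def boundedly_complete_over_def
      cofinite_eq_sequentially by blast
  have "(x \<longlongrightarrow> y) F"
    unfolding tendsto_iff_diff_neighborhood
  proof (intro allI impI)
    fix U :: "'a set"
    assume "neighborhood 0 U"
    then obtain V where V: "neighborhood 0 V" "\<And>a b. a \<in> V \<Longrightarrow> b \<in> V \<Longrightarrow> a - b \<in> U"
      using neighborhood_zero_diff by blast
    obtain B where B: "\<forall>\<^sub>F k in F. k \<in> B" "\<forall>\<^sub>F n in sequentially. \<forall>k\<in>B. ?y n - x k \<in> V"
      using close[OF V(1)] by blast
    have "\<forall>\<^sub>F n in sequentially. ?y n - y \<in> V"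
      using y V(1) unfolding tendsto_iff_diff_neighborhood by blast
    with B(2) have "\<forall>\<^sub>F n in sequentially. (\<forall>k\<in>B. ?y n - x k \<in> V) \<and> ?y n - y \<in> V"
      by (rule eventually_conj)
    then obtain n where n: "\<And>k. k \<in> B \<Longrightarrow> ?y n - x k \<in> V" "?y n - y \<in> V"
      using eventually_happens'[OF sequentially_bot] by blast
    have "x k - y \<in> U" if "k \<in> B" for k
      using V(2)[OF n(2) n(1)[OF that]] by simp
    with B(1) show "\<forall>\<^sub>F k in F. x k - y \<in> U"
      by (auto elim: eventually_mono)
  qed
  then show "\<exists>y. (x \<longlongrightarrow> y) F"
    by blast
qed

end

theorem corollary4p12:
  fixes smul :: "'k::real_normed_field \<Rightarrow> 'a::{topological_ab_group_add,t2_space} \<Rightarrow> 'a"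
    and f :: "real \<Rightarrow> real"
  assumes "locally_convex_space smul"
    and "boundedly_sequentially_complete smul"
    and "unbounded_modulus f"
  shows "boundedly_complete_over smul (f_st_filter f)"
proof -
  interpret locally_convex_space smul
    by fact
  have "modulus_function f"
    using assms(3) by (simp add: unbounded_modulus_def)
  then show ?thesis
    using assms(2,3)
    by (intro boundedly_complete_over_density_filter)
      (auto simp: eventually_f_st_filter intro: has_density_zero_imp_natural_density_zero)
qed

end
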